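(* Let $\Lambda_\pm$ be initial data as in the context, satisfying $\Lambda_-(x)<\Lambda_+(x)$, $\Lambda_-'(x)<0$ and $\Lambda_+'(x)<0$ for all $x\in\mathbb R$. Suppose there exist $\alpha_0<\beta_0$ with $\Lambda_-(\alpha_0)=\Lambda_+(\beta_0)$, $f(\alpha_0)=0$ and $f'(\alpha_0)<0$, where $f$ is the function defined in the context. Put $$t_0=\int_{\alpha_0}^{\beta_0}\frac{d\zeta}{\Lambda_+(\zeta)-\Lambda_-(\zeta)},\qquad x_0=\frac12\left\{\alpha_0+\beta_0+\int_{\alpha_0}^{\beta_0}\frac{\Lambda_+(\zeta)+\Lambda_-(\zeta)}{\Lambda_+(\zeta)-\Lambda_-(\zeta)}\,d\zeta\right\}.$$ Then the smooth solution $(\lambda_-,\lambda_+)$ of the Cauchy problem $$\partial_t\lambda_-+\lambda_+\partial_x\lambda_-=0,\qquad \partial_t\lambda_++\lambda_-\partial_x\lambda_+=0,\qquad \lambda_\pm(0,x)=\Lambda_\pm(x),$$ blows up at $(t_0,x_0)$, and $t_0$ is the blowup time, i.e. the life span of the $C^1$ solution (the Cauchy problem has a unique $C^1$ solution on $\{(t,x):0\le t<t_0,\ -\infty<x<\infty\}$). Furthermore, the blowup is a geometric blowup.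
   Context: The system is the Riemann-invariant form of the one-dimensional Chaplygin gas equations $\partial_t\rho+\partial_x(\rho u)=0$, $\partial_t(\rho u)+\partial_x(\rho u^2+p)=0$, $p=p_0-\mu^2/\rho$ ($p_0,\mu>0$ constants), with $\lambda_\pm=u\pm\mu/\rho$ and $\Lambda_\pm=u_0\pm\mu/\rho_0$, where $\rho_0$ and $u_0$ are the initial density and velocity. The initial data are suitably smooth, with $\rho_0,u_0$ having bounded $C^2$ norm. Let $\Sigma=\{(\alpha,\beta):\alpha<\beta,\ \Lambda_-(\alpha)=\Lambda_+(\beta)\}$. Since $\Lambda_+$ is strictly decreasing, for $(\alpha,\beta)\in\Sigma$ one has $\beta=\beta(\alpha)=\Lambda_+^{-1}(\Lambda_-(\alpha))$, and $f$ is defined by $$f(\alpha)=\frac{\Lambda_-'(\alpha)}{\Lambda_+(\beta(\alpha))-\Lambda_-(\beta(\alpha))}-\frac{\Lambda_+'(\beta(\alpha))}{\Lambda_+(\alpha)-\Lambda_-(\alpha)},$$ where $\Lambda_+'(\beta(\alpha))$ is the derivative of $\Lambda_+$ evaluated at the point $\beta(\alpha)$. Geometric blowup (roughly speaking, in the sense of Alinhac) means that the solution itself stays bounded, while its first-order derivatives go to infinity when $(t,x)$ tends to the blowup point.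
   Formalization: Adds the hypothesis that t_0 is at most the integral of 1/(Λ_+ − Λ_-) from α to β for every (α,β) in Σ; without it f(α_0)=0, f'(α_0)<0 gives only a local minimum of the meeting time, and the solution may break down before t_0. *)

theory Defs
  imports "HOL-Analysis.Analysis"
begin

definition bounded_C2 :: "(real \<Rightarrow> real) \<Rightarrow> bool" where
  "bounded_C2 g \<longleftrightarrow>
     (\<forall>k<2. \<forall>x. (deriv ^^ k) g differentiable (at x)) \<and>
     continuous_on UNIV ((deriv ^^ 2) g) \<and>
     (\<forall>k\<le>2. bounded (range ((deriv ^^ k) g)))"

text \<open>Initial values of the Riemann invariants \<open>u \<plusminus> \<mu> / \<rho>\<close>.\<close>

definition Lambda_minus :: "real \<Rightarrow> (real \<Rightarrow> real) \<Rightarrow> (real \<Rightarrow> real) \<Rightarrow> real \<Rightarrow> real" where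
  "Lambda_minus \<mu> \<rho>0 u0 x = u0 x - \<mu> / \<rho>0 x"

definition Lambda_plus :: "real \<Rightarrow> (real \<Rightarrow> real) \<Rightarrow> (real \<Rightarrow> real) \<Rightarrow> real \<Rightarrow> real" where
  "Lambda_plus \<mu> \<rho>0 u0 x = u0 x + \<mu> / \<rho>0 x"

text \<open>In the following, \<open>Lm\<close> and \<open>Lp\<close> stand for \<open>\<Lambda>\<^sub>-\<close> and \<open>\<Lambda>\<^sub>+\<close>.\<close>

definition Sigma_curve :: "(real \<Rightarrow> real) \<Rightarrow> (real \<Rightarrow> real) \<Rightarrow> (real \<times> real) set" where
  "Sigma_curve Lm Lp = {(\<alpha>, \<beta>). \<alpha> < \<beta> \<and> Lm \<alpha> = Lp \<beta>}"

text \<open>Meaningful only when \<open>Lm \<alpha>\<close> is in the range of the injective function \<open>Lp\<close>;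
  the admissible \<open>\<alpha>\<close> then form an open set.\<close>

definition beta_of :: "(real \<Rightarrow> real) \<Rightarrow> (real \<Rightarrow> real) \<Rightarrow> real \<Rightarrow> real" where
  "beta_of Lm Lp \<alpha> = inv Lp (Lm \<alpha>)"

definition f_fun :: "(real \<Rightarrow> real) \<Rightarrow> (real \<Rightarrow> real) \<Rightarrow> real \<Rightarrow> real" where
  "f_fun Lm Lp \<alpha> =
     deriv Lm \<alpha> / (Lp (beta_of Lm Lp \<alpha>) - Lm (beta_of Lm Lp \<alpha>))
     - deriv Lp (beta_of Lm Lp \<alpha>) / (Lp \<alpha> - Lm \<alpha>)"

text \<open>Time and place at which the characteristic \<open>dx/dt = \<lambda>\<^sub>+\<close> issuing from \<open>\<alpha>\<close> meets the
  characteristic \<open>dx/dt = \<lambda>\<^sub>-\<close> issuing from \<open>\<beta> \<ge> \<alpha>\<close>. Along \<open>\<Sigma>\<close>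
  the meeting time has \<open>\<alpha>\<close>-derivative \<open>f(\<alpha>) / \<Lambda>\<^sub>+'(\<beta>(\<alpha>))\<close>, so \<open>f(\<alpha>\<^sub>0) = 0\<close> and \<open>f'(\<alpha>\<^sub>0) < 0\<close>
  make \<open>\<alpha>\<^sub>0\<close> a strict local minimum point of it, not necessarily a global one.\<close>

definition meet_time :: "(real \<Rightarrow> real) \<Rightarrow> (real \<Rightarrow> real) \<Rightarrow> real \<Rightarrow> real \<Rightarrow> real" where
  "meet_time Lm Lp \<alpha> \<beta> = integral {\<alpha>..\<beta>} (\<lambda>\<zeta>. 1 / (Lp \<zeta> - Lm \<zeta>))"

definition meet_place :: "(real \<Rightarrow> real) \<Rightarrow> (real \<Rightarrow> real) \<Rightarrow> real \<Rightarrow> real \<Rightarrow> real" where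
  "meet_place Lm Lp \<alpha> \<beta> =
     1 / 2 * (\<alpha> + \<beta> + integral {\<alpha>..\<beta>} (\<lambda>\<zeta>. (Lp \<zeta> + Lm \<zeta>) / (Lp \<zeta> - Lm \<zeta>)))"

text \<open>Points of space-time are pairs \<open>(t, x)\<close>.\<close>

definition strip :: "real \<Rightarrow> (real \<times> real) set" where
  "strip T = {0..<T} \<times> UNIV"

text \<open>The time derivative is one-sided at \<open>t = 0\<close>.\<close>

definition dt :: "real \<Rightarrow> (real \<times> real \<Rightarrow> real) \<Rightarrow> real \<times> real \<Rightarrow> real" where
  "dt T v z = vector_derivative (\<lambda>s. v (s, snd z)) (at (fst z) within {0..<T})"

definition dx :: "(real \<times> real \<Rightarrow> real) \<Rightarrow> real \<times> real \<Rightarrow> real" where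
  "dx v z = deriv (\<lambda>y. v (fst z, y)) (snd z)"

definition C1_on_strip :: "real \<Rightarrow> (real \<times> real \<Rightarrow> real) \<Rightarrow> bool" where
  "C1_on_strip T v \<longleftrightarrow>
     (\<forall>z\<in>strip T. (v has_derivative (\<lambda>(h, k). dt T v z * h + dx v z * k)) (at z within strip T)) \<and>
     continuous_on (strip T) (dt T v) \<and> continuous_on (strip T) (dx v)"

definition C1_solution ::
  "(real \<Rightarrow> real) \<Rightarrow> (real \<Rightarrow> real) \<Rightarrow> real
    \<Rightarrow> (real \<times> real \<Rightarrow> real) \<Rightarrow> (real \<times> real \<Rightarrow> real) \<Rightarrow> bool" where
  "C1_solution Lm Lp T lm lp \<longleftrightarrow>
     C1_on_strip T lm \<and> C1_on_strip T lp \<and>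
     (\<forall>z\<in>strip T. dt T lm z + lp z * dx lm z = 0 \<and> dt T lp z + lm z * dx lp z = 0) \<and>
     (\<forall>x. lm (0, x) = Lm x \<and> lp (0, x) = Lp x)"

definition is_life_span :: "(real \<Rightarrow> real) \<Rightarrow> (real \<Rightarrow> real) \<Rightarrow> real \<Rightarrow> bool" where
  "is_life_span Lm Lp T \<longleftrightarrow>
     T > 0 \<and> (\<exists>lm lp. C1_solution Lm Lp T lm lp) \<and>
     (\<forall>T'>T. \<not> (\<exists>lm lp. C1_solution Lm Lp T' lm lp))"

text \<open>Near \<open>z0\<close> the solution is not bounded in the \<open>C\<^sup>1\<close> norm.\<close>

definition blows_up_at ::
  "real \<Rightarrow> (real \<times> real \<Rightarrow> real) \<Rightarrow> (real \<times> real \<Rightarrow> real) \<Rightarrow> real \<times> real \<Rightarrow> bool" where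
  "blows_up_at T lm lp z0 \<longleftrightarrow>
     (\<forall>e>0. \<not> bounded ((\<lambda>z. (lm z, lp z, dt T lm z, dx lm z, dt T lp z, dx lp z))
                       ` (strip T \<inter> ball z0 e)))"

text \<open>By the equations, \<open>dt T lm = - lp * dx lm\<close> and \<open>dt T lp = - lm * dx lp\<close>: while the solution
  is bounded, the gradients tend to infinity iff the \<open>x\<close>-derivatives do. The \<open>t\<close>-derivatives
  alone need not, since the speeds may vanish at \<open>z0\<close>.\<close>

definition geometric_blowup_at ::
  "real \<Rightarrow> (real \<times> real \<Rightarrow> real) \<Rightarrow> (real \<times> real \<Rightarrow> real) \<Rightarrow> real \<times> real \<Rightarrow> bool" where
  "geometric_blowup_at T lm lp z0 \<longleftrightarrow>
     bounded (lm ` strip T) \<and> bounded (lp ` strip T) \<and>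
     filterlim (dx lm) at_infinity (at z0 within strip T) \<and>
     filterlim (dx lp) at_infinity (at z0 within strip T)"

end

theory Submission
  imports Defs
begin

text \<open>The system becomes explicit in Lagrangian coordinates. Let \<open>P' = 1 / (\<Lambda>\<^sub>+ - \<Lambda>\<^sub>-)\<close>, let \<open>q\<close> be
the inverse of \<open>P\<close>, and put \<open>m = \<Lambda>\<^sub>- \<circ> q\<close>, \<open>p = \<Lambda>\<^sub>+ \<circ> q\<close>, so that \<open>q' = p - m\<close>; up to
constants, \<open>P x\<close> is the initial mass between a reference point and \<open>x\<close>. Label the
characteristics of speed \<open>\<lambda>\<^sub>+\<close> by \<open>a = P x\<close>, where \<open>x\<close> is the starting point. In the \<open>(t, a)\<close>
plane both families are straight lines: those of speed \<open>\<lambda>\<^sub>+\<close> keep \<open>a\<close> fixed and carry the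
value \<open>m a\<close> of \<open>\<lambda>\<^sub>-\<close>, those of speed \<open>\<lambda>\<^sub>-\<close> keep \<open>a + t\<close> fixed and carry the value \<open>p (a + t)\<close>
of \<open>\<lambda>\<^sub>+\<close>. Hence, if \<open>F' = p\<close>, the characteristic with label \<open>a\<close> is at time \<open>t\<close> at
\<open>X t a = q a + F (a + t) - F a\<close>, and the solution must be \<open>\<lambda>\<^sub>-(t, X t a) = m a\<close>,
\<open>\<lambda>\<^sub>+(t, X t a) = p (a + t)\<close>. Everything is decided by \<open>\<partial>X/\<partial>a = p (a + t) - m a\<close>; call
\<open>(t, a)\<close> a fold if it vanishes there.

While this derivative is positive for all \<open>a\<close>, the map \<open>X t\<close> is a diffeomorphism of the line
and the formulas define a classical solution (\<open>lm_lp_is_solution\<close>). There is a fold at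
\<open>(t, a)\<close>, \<open>t > 0\<close>, exactly when \<open>(q a, q (a + t))\<close> lies on \<open>\<Sigma>\<close>, and then \<open>t\<close> is the meeting
time of that pair. So minimality of \<open>t\<^sub>0\<close> says that there is no fold before \<open>t\<^sub>0\<close>
(\<open>first_fold_time\<close>).

Conversely, every \<open>C\<^sup>1\<close> solution on a strip obeys the two formulas above at every label
(\<open>solution_on_characteristics\<close>): the deviations satisfy a linear system along straight lines
in the \<open>(t, a)\<close> plane. This gives uniqueness on \<open>t < t\<^sub>0\<close>, even against solutions that may
grow at infinity. It also shows that no solution exists beyond \<open>t\<^sub>0\<close>: differentiating
\<open>\<lambda>\<^sub>-(t\<^sub>0, X t\<^sub>0 a) = m a\<close> at the fold \<open>a\<^sub>0 = P \<alpha>\<^sub>0\<close> would give \<open>0 = m' a\<^sub>0 < 0\<close>.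

For the blowup, \<open>\<partial>\<lambda>\<^sub>-/\<partial>x = m' a / (p (a + t) - m a)\<close>, and likewise for \<open>\<lambda>\<^sub>+\<close>. These quotients
tend to infinity at \<open>(t\<^sub>0, x\<^sub>0)\<close> as soon as the label of \<open>(t, x)\<close> tends to \<open>a\<^sub>0\<close>, and for that
\<open>X t\<^sub>0\<close> must not be constant on an interval ending at \<open>a\<^sub>0\<close>. On such an interval
\<open>p (a + t\<^sub>0) = m a\<close> would hold identically, which forces \<open>f (q a) = 0\<close> there
(\<open>f_fun_zero_on_flat_fold\<close>), contrary to \<open>f'(\<alpha>\<^sub>0) < 0\<close>.\<close>

section \<open>Calculus on the line\<close>

lemma real_derivative_of_inverse:
  fixes f g f' :: "real \<Rightarrow> real"
  assumes f: "\<And>x. (f has_real_derivative f' x) (at x)"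
    and nz: "f' x \<noteq> 0" and g: "\<And>z. g (f z) = z"
  shows "(g has_real_derivative inverse (f' x)) (at (f x))"
  unfolding has_field_derivative_def
proof (rule has_derivative_inverse_strong[where f = f and x = x and S = UNIV and f' = "\<lambda>h. f' x * h"])
  show "continuous_on UNIV f"
    by (rule DERIV_continuous_on[OF has_field_derivative_at_within[OF f]])
  show "(f has_derivative (\<lambda>h. f' x * h)) (at x)"
    using f[of x] by (simp add: has_field_derivative_def)
  show "(\<lambda>h. f' x * h) \<circ> (\<lambda>h. inverse (f' x) * h) = id"
    using nz by (auto simp: fun_eq_iff)
qed (use g in auto)

lemma real_antiderivative_exists:
  fixes f :: "real \<Rightarrow> real"
  assumes "\<And>x. isCont f x"
  obtains F where "\<And>x. (F has_real_derivative f x) (at x)"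
proof -
  obtain F where "\<forall>x. (F has_vector_derivative f x) (at x)"
    using einterval_antiderivative[of "-\<infinity>" "\<infinity>" f] assms by auto
  then show thesis
    by (intro that[of F]) (simp add: has_real_derivative_iff_has_vector_derivative)
qed

lemma decreasing_zero_isolated:
  fixes h :: "real \<Rightarrow> real"
  assumes h: "(h has_real_derivative l) (at a0)" "l < 0" "h a0 = 0"
    and "c < d" "c = a0 \<or> d = a0"
  shows "\<exists>a. c < a \<and> a < d \<and> h a \<noteq> 0"
  using assms(5)
proof
  assume c: "c = a0"
  obtain e where e: "e > 0" "\<And>k. 0 < k \<Longrightarrow> k < e \<Longrightarrow> h (a0 + k) < h a0"
    using DERIV_neg_dec_right[OF h(1,2)] by auto
  define k where "k = min (e / 2) ((d - c) / 2)"
  have "0 < k" "k < e" "k < d - c" using e(1) \<open>c < d\<close> by (auto simp: k_def min_def field_simps)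
  then show ?thesis using e(2)[of k] h(3) c by (intro exI[of _ "a0 + k"]) auto
next
  assume d: "d = a0"
  obtain e where e: "e > 0" "\<And>k. 0 < k \<Longrightarrow> k < e \<Longrightarrow> h a0 < h (a0 - k)"
    using DERIV_neg_dec_left[OF h(1,2)] by auto
  define k where "k = min (e / 2) ((d - c) / 2)"
  have "0 < k" "k < e" "k < d - c" using e(1) \<open>c < d\<close> by (auto simp: k_def min_def field_simps)
  then show ?thesis using e(2)[of k] h(3) d by (intro exI[of _ "a0 - k"]) auto
qed

lemma infinite_limit_imp_unbounded:
  fixes f :: "'a::metric_space \<Rightarrow> 'b::real_normed_vector"
  assumes f: "filterlim f at_infinity (at z within S)" and z: "z islimpt S" and "e > 0"
  shows "\<not> bounded (f ` (S \<inter> ball z e))"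
proof
  assume "bounded (f ` (S \<inter> ball z e))"
  then obtain B where B: "\<And>y. y \<in> S \<Longrightarrow> dist y z < e \<Longrightarrow> norm (f y) \<le> B"
    by (metis IntI bounded_iff dist_commute imageI mem_ball)
  have "\<forall>\<^sub>F y in at z within S. \<bar>B\<bar> + 1 \<le> norm (f y)"
    using f[unfolded filterlim_at_infinity[OF order_refl]] by simp
  moreover have "\<forall>\<^sub>F y in at z within S. y \<in> S \<and> dist y z < e"
    unfolding eventually_at using \<open>e > 0\<close> by auto
  ultimately have "\<forall>\<^sub>F y in at z within S. False"
    by eventually_elim (use B in fastforce)
  then show False
    using z by (simp add: trivial_limit_within)
qed

section \<open>Continuously differentiable functions on a strip\<close>

lemma strip_time_slice:
  assumes "(v has_derivative D) (at (s, x) within strip T)"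
  shows "((\<lambda>r. v (r, x)) has_vector_derivative D (1, 0)) (at s within {0..<T})"
proof -
  interpret D: bounded_linear D
    using assms(1) by (rule has_derivative_bounded_linear)
  have "((\<lambda>r. v (r, x)) has_derivative (\<lambda>h. D (h, 0))) (at s within {0..<T})"
    by (rule has_derivative_in_compose[where f = "\<lambda>r. (r, x)" and g = v])
      (auto intro!: derivative_eq_intros has_derivative_subset[OF assms(1)] simp: strip_def)
  moreover have "(\<lambda>h. D (h, 0)) = (\<lambda>h. h *\<^sub>R D (1, 0))"
  proof
    fix h :: real
    have "(h, 0) = h *\<^sub>R (1, 0 :: real)" by simp
    then show "D (h, 0) = h *\<^sub>R D (1, 0)" by (metis D.scaleR)
  qed
  ultimately show ?thesis unfolding has_vector_derivative_def by metis
qed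

lemma strip_space_slice:
  assumes "(v has_derivative D) (at (s, x) within strip T)" "0 \<le> s" "s < T"
  shows "((\<lambda>y. v (s, y)) has_real_derivative D (0, 1)) (at x)"
proof -
  interpret D: bounded_linear D
    using assms(1) by (rule has_derivative_bounded_linear)
  have "((\<lambda>y. v (s, y)) has_derivative (\<lambda>h. D (0, h))) (at x)"
    by (rule has_derivative_in_compose[where f = "\<lambda>y. (s, y)" and g = v])
      (use assms in \<open>auto intro!: derivative_eq_intros has_derivative_subset[OF assms(1)] simp: strip_def\<close>)
  moreover have "(\<lambda>h. D (0, h)) = (\<lambda>h. D (0, 1) * h)"
  proof
    fix h :: real
    have "(0, h) = h *\<^sub>R (0 :: real, 1)" by simp
    then show "D (0, h) = D (0, 1) * h" by (metis D.scaleR mult.commute real_scaleR_def)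
  qed
  ultimately show ?thesis unfolding has_field_derivative_def by metis
qed

text \<open>A total derivative within the strip restricts to the horizontal and the vertical slice
through the point, and derivatives along these slices are unique, at \<open>t = 0\<close> too. So any
representation of the total derivative identifies \<open>dt\<close> and \<open>dx\<close>.\<close>

lemma C1_on_strip_intro:
  assumes v: "\<And>z. z \<in> strip T \<Longrightarrow> (v has_derivative (\<lambda>(h, k). a z * h + b z * k)) (at z within strip T)"
    and a: "continuous_on (strip T) a" and b: "continuous_on (strip T) b"
  shows "C1_on_strip T v"
    and "\<And>z. z \<in> strip T \<Longrightarrow> dt T v z = a z"
    and "\<And>z. z \<in> strip T \<Longrightarrow> dx v z = b z"
proof -
  have dt: "dt T v z = a z" and dx: "dx v z = b z" if z: "z \<in> strip T" for z
  proof -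
    obtain s x where [simp]: "z = (s, x)" by fastforce
    have s: "0 \<le> s" "s < T" using z by (auto simp: strip_def)
    have "at s within {0..<T} \<noteq> bot"
      using s by (simp add: trivial_limit_within)
    then show "dt T v z = a z"
      using strip_time_slice[OF v[OF z, simplified]] by (simp add: dt_def vector_derivative_within)
    show "dx v z = b z"
      using strip_space_slice[OF v[OF z, simplified] s] by (simp add: dx_def DERIV_imp_deriv)
  qed
  show "C1_on_strip T v"
    unfolding C1_on_strip_def
    using v a b by (simp add: dt dx cong: continuous_on_cong)
  show "\<And>z. z \<in> strip T \<Longrightarrow> dt T v z = a z" "\<And>z. z \<in> strip T \<Longrightarrow> dx v z = b z"
    using dt dx by auto
qed

text \<open>A function that is \<open>C\<^sup>1\<close> on the strip is differentiable in the full sense at interior points,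
so the chain rule applies to it along curves \<open>x = c(t)\<close> that stay away from \<open>t = 0\<close>.\<close>

lemma C1_on_strip_along_curve:
  assumes v: "C1_on_strip T v" and t: "0 < t" "t < T"
    and c: "(c has_real_derivative s) (at t)"
  shows "((\<lambda>r. v (r, c r)) has_real_derivative dt T v (t, c t) + s * dx v (t, c t)) (at t)"
proof -
  let ?D = "\<lambda>(h, k). dt T v (t, c t) * h + dx v (t, c t) * k"
  have "(t, c t) \<in> interior (strip T)"
    using t by (simp add: strip_def interior_Times)
  then have "at (t, c t) within strip T = at (t, c t)"
    by (rule at_within_interior)
  moreover have "(t, c t) \<in> strip T" using t by (simp add: strip_def)
  ultimately have vD: "(v has_derivative ?D) (at (t, c t))"
    using v unfolding C1_on_strip_def by metis
  have "((\<lambda>r. (r, c r)) has_derivative (\<lambda>h. (h, s * h))) (at t)"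
    using c by (auto intro!: derivative_eq_intros simp: has_field_derivative_def)
  from has_derivative_compose[OF this vD]
  have "((\<lambda>r. v (r, c r)) has_derivative (\<lambda>h. ?D (h, s * h))) (at t)" .
  moreover have "(\<lambda>h. ?D (h, s * h)) = (*) (dt T v (t, c t) + s * dx v (t, c t))"
    by (auto simp: algebra_simps)
  ultimately show ?thesis by (simp add: has_field_derivative_def)
qed

lemma C1_on_strip_continuous: "C1_on_strip T v \<Longrightarrow> continuous_on (strip T) v"
  unfolding C1_on_strip_def continuous_on_eq_continuous_within
  by (meson has_derivative_continuous)

section \<open>Characteristics in Lagrangian coordinates\<close>

text \<open>Here \<open>a\<close> is a mass label, \<open>q a\<close> the initial position that it names, and \<open>m\<close>, \<open>p\<close> are the
initial Riemann invariants as functions of the label. The relation \<open>q' = p - m\<close> is what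
straightens both families of characteristics at once.\<close>

locale lagrangian_data =
  fixes Lm Lp q m p m' p' F :: "real \<Rightarrow> real"
  assumes m_deriv: "\<And>a. (m has_real_derivative m' a) (at a)"
    and p_deriv: "\<And>a. (p has_real_derivative p' a) (at a)"
    and q_deriv: "\<And>a. (q has_real_derivative p a - m a) (at a)"
    and F_deriv: "\<And>a. (F has_real_derivative p a) (at a)"
    and m'_cont: "continuous_on UNIV m'" and p'_cont: "continuous_on UNIV p'"
    and m'_neg: "\<And>a. m' a < 0" and p'_neg: "\<And>a. p' a < 0"
    and Lm_q: "\<And>a. Lm (q a) = m a" and Lp_q: "\<And>a. Lp (q a) = p a"
    and surj_q: "surj q"
    and m_bdd: "bounded (range m)" and p_bdd: "bounded (range p)"
begin

text \<open>The position at time \<open>t\<close> of the characteristic of speed \<open>\<lambda>\<^sub>+\<close> issuing from \<open>q a\<close>: at time \<open>s\<close>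
this speed is \<open>p (a + s)\<close>, and \<open>F\<close> is an antiderivative of \<open>p\<close>.\<close>

definition X :: "real \<Rightarrow> real \<Rightarrow> real" where
  "X t a = q a + (F (a + t) - F a)"

lemma X_0 [simp]: "X 0 a = q a"
  by (simp add: X_def)

lemma X_has_derivative:
  "((\<lambda>z. X (fst z) (snd z)) has_derivative (\<lambda>(h, k). p (a + t) * h + (p (a + t) - m a) * k)) (at (t, a))"
proof -
  note [derivative_intros] =
    DERIV_compose_FDERIV[OF q_deriv] DERIV_compose_FDERIV[OF F_deriv]
  show ?thesis
    unfolding X_def case_prod_beta
    by (auto intro!: derivative_eq_intros simp: algebra_simps)
qed

lemma X_deriv_t: "((\<lambda>s. X s a) has_real_derivative p (a + t)) (at t)"
  unfolding X_def by (auto intro!: derivative_eq_intros DERIV_chain'[OF _ F_deriv])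

lemma X_deriv_a: "(X t has_real_derivative p (a + t) - m a) (at a)"
  unfolding X_def
  by (auto intro!: derivative_eq_intros q_deriv F_deriv DERIV_chain'[OF _ F_deriv])

text \<open>The lines on which \<open>a + t\<close> is constant are the characteristics of the other family: along
them the contribution \<open>p\<close> of the time derivative cancels against \<open>\<partial>X/\<partial>a = p - m\<close>, and the
speed \<open>m\<close> is left.\<close>

lemma X_deriv_minus: "((\<lambda>s. X s (b - s)) has_real_derivative m (b - t)) (at t)"
  unfolding X_def
  by (auto intro!: derivative_eq_intros DERIV_chain'[OF _ F_deriv] DERIV_chain'[OF _ q_deriv])

lemma X_continuous: "continuous_on S (\<lambda>z. X (fst z) (snd z))"
  unfolding continuous_on_eq_continuous_within
  using has_derivative_continuous[OF has_derivative_at_withinI[OF X_has_derivative]] by auto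

text \<open>Since \<open>p\<close> is bounded, \<open>X t\<close> differs from the surjective map \<open>q\<close> by a bounded amount.\<close>

lemma surj_X: "surj (X t)"
proof -
  obtain M where M: "\<And>a. \<bar>p a\<bar> \<le> M"
    using p_bdd by (auto simp: bounded_iff)
  have bd: "\<bar>X t a - q a\<bar> \<le> M * \<bar>t\<bar>" for a
  proof -
    have "norm (F (a + t) - F a) \<le> M * norm (a + t - a)"
      by (rule field_differentiable_bound[of UNIV _ p])
        (use M F_deriv in auto)
    then show ?thesis by (simp add: X_def)
  qed
  have "\<exists>a. X t a = x" for x
  proof -
    obtain a b where a: "q a = x - M * \<bar>t\<bar>" and b: "q b = x + M * \<bar>t\<bar>"
      using surj_q by (metis surjD)
    have "X t a \<le> x" "x \<le> X t b" using bd[of a] bd[of b] a b by linarith+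
    moreover have "connected (range (X t))"
      by (rule connected_continuous_image)
        (use DERIV_isCont[OF X_deriv_a] in \<open>auto simp: continuous_on_eq_continuous_at\<close>)
    ultimately have "x \<in> range (X t)"
      by (meson connectedD_interval rangeI)
    then show ?thesis by auto
  qed
  then show ?thesis by (metis surjI)
qed

lemma m_cont: "continuous_on S m" and p_cont: "continuous_on S p"
  by (rule DERIV_continuous_on[OF has_field_derivative_at_within], rule m_deriv p_deriv)+

section \<open>Solutions are determined by the characteristics\<close>

text \<open>Let \<open>W\<close> and \<open>V\<close> be the deviations of \<open>\<lambda>\<^sub>-\<close> from \<open>m\<close> and of \<open>\<lambda>\<^sub>+\<close> from \<open>p\<close>. The equations turn
into \<open>dW/dt = - V \<partial>\<lambda>\<^sub>-/\<partial>x\<close> for fixed \<open>a\<close> and \<open>dV/dt = - W \<partial>\<lambda>\<^sub>+/\<partial>x\<close> for fixed \<open>a + t\<close>. These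
lines do not depend on the unknown solution, which need not be bounded, so the domain of
dependence of \<open>(t, a)\<close> is a compact triangle, on which the coefficients are bounded by some
\<open>L\<close>. Measuring \<open>W\<close> and \<open>V\<close> with the weight \<open>exp (- 2 L t)\<close> makes the system a contraction by
the factor \<open>1/2\<close>, so both vanish.\<close>

lemma solution_on_characteristics:
  assumes sol: "C1_solution Lm Lp T lm lp" and t: "0 \<le> t" "t < T"
  shows "lm (t, X t a) = m a" and "lp (t, X t a) = p (a + t)"
proof -
  define W where "W = (\<lambda>(s, c). lm (s, X s c) - m c)"
  define V where "V = (\<lambda>(s, c). lp (s, X s c) - p (c + s))"
  \<comment> \<open>The domain of dependence of \<open>(t, a)\<close>: the triangle below this point.\<close>
  define K where "K = ({0..t} \<times> {a..a + t}) \<inter> {z. fst z + snd z \<le> a + t}"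
  have "compact K"
    unfolding K_def
    by (intro compact_Int_closed compact_Times closed_Collect_le continuous_intros) auto
  have lm: "C1_on_strip T lm" and lp: "C1_on_strip T lp"
    using sol by (auto simp: C1_solution_def)
  have eqs: "dt T lm (s, x) + lp (s, x) * dx lm (s, x) = 0"
    "dt T lp (s, x) + lm (s, x) * dx lp (s, x) = 0" if "0 \<le> s" "s < T" for s x
    using sol that by (auto simp: C1_solution_def strip_def)
  have init: "W (0, c) = 0" "V (0, c) = 0" for c
    using sol by (auto simp: W_def V_def C1_solution_def Lm_q Lp_q)
  have graph: "continuous_on K (\<lambda>z. g (fst z, X (fst z) (snd z)))"
    if "continuous_on (strip T) g" for g :: "real \<times> real \<Rightarrow> real"
    by (rule continuous_on_compose2[OF that])
      (use t X_continuous[of K] in \<open>auto intro!: continuous_intros simp: case_prod_beta K_def strip_def\<close>)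
  have Wc: "continuous_on K W" and Vc: "continuous_on K V"
    unfolding W_def V_def case_prod_beta
    by (intro continuous_intros graph C1_on_strip_continuous lm lp
        continuous_on_compose2[OF m_cont[of UNIV]] continuous_on_compose2[OF p_cont[of UNIV]]; simp)+
  have "compact ((\<lambda>z. (dx lm (fst z, X (fst z) (snd z)), dx lp (fst z, X (fst z) (snd z)))) ` K)"
    using lm lp unfolding C1_on_strip_def
    by (intro compact_continuous_image continuous_intros graph \<open>compact K\<close>) auto
  then obtain L where "L > 0" and L: "\<And>z. z \<in> K \<Longrightarrow>
      norm (dx lm (fst z, X (fst z) (snd z)), dx lp (fst z, X (fst z) (snd z))) \<le> L"
    using compact_imp_bounded[THEN bounded_pos[THEN iffD1]] by (metis (no_types, lifting) imageI)
  have L1: "\<bar>dx lm (s, X s c)\<bar> \<le> L" and L2: "\<bar>dx lp (s, X s c)\<bar> \<le> L" if "(s, c) \<in> K" for s c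
    using L[OF that] norm_fst_le[of "dx lm (s, X s c)" "dx lp (s, X s c)"]
      norm_snd_le[of "dx lp (s, X s c)" "dx lm (s, X s c)"] by (auto intro: order_trans)
  define N where "N = (\<lambda>z. exp (- (2 * L * fst z)) * max \<bar>W z\<bar> \<bar>V z\<bar>)"
  have "continuous_on K N"
    unfolding N_def by (intro continuous_intros Wc Vc)
  moreover have "(t, a) \<in> K" using t by (simp add: K_def)
  ultimately obtain z1 where z1: "z1 \<in> K" "\<And>z. z \<in> K \<Longrightarrow> N z \<le> N z1"
    using continuous_attains_sup[OF \<open>compact K\<close>] by blast
  obtain t1 a1 where z1_eq: "z1 = (t1, a1)" by fastforce
  define n where "n = N z1"
  have t1: "0 \<le> t1" "t1 \<le> t" "a \<le> a1" "a1 + t1 \<le> a + t"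
    using z1(1) by (auto simp: z1_eq K_def)
  have "n \<ge> 0" by (simp add: n_def N_def)
  have WV: "\<bar>W (s, c)\<bar> \<le> n * exp (2 * L * s)" "\<bar>V (s, c)\<bar> \<le> n * exp (2 * L * s)"
    if "(s, c) \<in> K" for s c
  proof -
    have "exp (- (2 * L * s)) * max \<bar>W (s, c)\<bar> \<bar>V (s, c)\<bar> \<le> n"
      using z1(2)[OF that] by (simp add: N_def n_def)
    then have "max \<bar>W (s, c)\<bar> \<bar>V (s, c)\<bar> \<le> n * exp (2 * L * s)"
      by (simp add: exp_minus field_simps)
    then show "\<bar>W (s, c)\<bar> \<le> n * exp (2 * L * s)" "\<bar>V (s, c)\<bar> \<le> n * exp (2 * L * s)"
      by auto
  qed
  \<comment> \<open>Half of \<open>exp (2 L s)\<close> is the antiderivative of \<open>L exp (2 L s)\<close>: hence the factor \<open>1/2\<close>.\<close>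
  have phi: "((\<lambda>s. n / 2 * exp (2 * L * s)) has_vector_derivative L * (n * exp (2 * L * s))) (at s)" for s
    unfolding has_real_derivative_iff_has_vector_derivative[symmetric]
    by (auto intro!: derivative_eq_intros)
  have half: "\<bar>g t1 - g 0\<bar> \<le> n / 2 * exp (2 * L * t1) - n / 2"
    if "continuous_on {0..t1} g"
      and "\<And>s. 0 < s \<Longrightarrow> s < t1 \<Longrightarrow> (g has_real_derivative g' s) (at s)"
      and "\<And>s. 0 < s \<Longrightarrow> s < t1 \<Longrightarrow> \<bar>g' s\<bar> \<le> L * (n * exp (2 * L * s))" for g g'
  proof (cases "t1 = 0")
    case False
    then have "norm (g t1 - g 0) \<le> n / 2 * exp (2 * L * t1) - n / 2 * exp (2 * L * 0)"
      using t1(1) that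
      by (intro differentiable_bound_general[where f' = g'
            and \<phi>' = "\<lambda>s. L * (n * exp (2 * L * s))"] phi continuous_intros)
        (auto simp: has_real_derivative_iff_has_vector_derivative)
    then show ?thesis by simp
  qed auto
  \<comment> \<open>Both lines through the maximum point, followed back to time 0, stay in the triangle.\<close>
  have "\<bar>W (t1, a1) - W (0, a1)\<bar> \<le> n / 2 * exp (2 * L * t1) - n / 2"
  proof (rule half)
    have in_K: "(s, a1) \<in> K" if "0 \<le> s" "s \<le> t1" for s
      using that t1 by (simp add: K_def)
    show "continuous_on {0..t1} (\<lambda>s. W (s, a1))"
      by (rule continuous_on_compose2[OF Wc]) (auto intro!: continuous_intros in_K)
    fix s assume s: "0 < s" "s < t1"
    then have "s < T" using t t1 by simp
    have "((\<lambda>s. W (s, a1)) has_real_derivative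
        dt T lm (s, X s a1) + p (a1 + s) * dx lm (s, X s a1)) (at s)"
      unfolding W_def
      by (auto intro!: derivative_eq_intros
          C1_on_strip_along_curve[OF lm \<open>0 < s\<close> \<open>s < T\<close> X_deriv_t])
    also have "dt T lm (s, X s a1) + p (a1 + s) * dx lm (s, X s a1)
        = - V (s, a1) * dx lm (s, X s a1)"
      using eqs(1)[of s "X s a1"] s \<open>s < T\<close> by (simp add: V_def algebra_simps)
    finally show "((\<lambda>s. W (s, a1)) has_real_derivative - V (s, a1) * dx lm (s, X s a1)) (at s)" .
    have "\<bar>V (s, a1)\<bar> * \<bar>dx lm (s, X s a1)\<bar> \<le> (n * exp (2 * L * s)) * L"
      using in_K s WV L1 \<open>n \<ge> 0\<close> by (intro mult_mono) auto
    then show "\<bar>- V (s, a1) * dx lm (s, X s a1)\<bar> \<le> L * (n * exp (2 * L * s))"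
      by (simp add: abs_mult mult_ac)
  qed
  moreover
  have "\<bar>V (t1, a1 + t1 - t1) - V (0, a1 + t1 - 0)\<bar> \<le> n / 2 * exp (2 * L * t1) - n / 2"
  proof (rule half)
    let ?c = "\<lambda>s. a1 + t1 - s"
    have in_K: "(s, ?c s) \<in> K" if "0 \<le> s" "s \<le> t1" for s
      using that t1 by (simp add: K_def)
    show "continuous_on {0..t1} (\<lambda>s. V (s, ?c s))"
      by (rule continuous_on_compose2[OF Vc]) (auto intro!: continuous_intros in_K)
    fix s assume s: "0 < s" "s < t1"
    then have "s < T" using t t1 by simp
    have "((\<lambda>s. V (s, ?c s)) has_real_derivative
        dt T lp (s, X s (?c s)) + m (?c s) * dx lp (s, X s (?c s))) (at s)"
      unfolding V_def
      using C1_on_strip_along_curve[OF lp \<open>0 < s\<close> \<open>s < T\<close> X_deriv_minus]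
      by (auto intro!: derivative_eq_intros)
    also have "dt T lp (s, X s (?c s)) + m (?c s) * dx lp (s, X s (?c s))
        = - W (s, ?c s) * dx lp (s, X s (?c s))"
      using eqs(2)[of s "X s (?c s)"] s \<open>s < T\<close> by (simp add: W_def algebra_simps)
    finally show "((\<lambda>s. V (s, ?c s)) has_real_derivative
        - W (s, ?c s) * dx lp (s, X s (?c s))) (at s)" .
    have "\<bar>W (s, ?c s)\<bar> * \<bar>dx lp (s, X s (?c s))\<bar> \<le> (n * exp (2 * L * s)) * L"
      using in_K s WV L2 \<open>n \<ge> 0\<close> by (intro mult_mono) auto
    then show "\<bar>- W (s, ?c s) * dx lp (s, X s (?c s))\<bar> \<le> L * (n * exp (2 * L * s))"
      by (simp add: abs_mult mult_ac)
  qed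
  ultimately have "max \<bar>W (t1, a1)\<bar> \<bar>V (t1, a1)\<bar> \<le> n / 2 * exp (2 * L * t1)"
    using init \<open>n \<ge> 0\<close> by auto
  moreover have "max \<bar>W (t1, a1)\<bar> \<bar>V (t1, a1)\<bar> = n * exp (2 * L * t1)"
    by (simp add: n_def N_def z1_eq exp_minus field_simps)
  ultimately have "n * exp (2 * L * t1) \<le> 0" by simp
  then have "n = 0" using \<open>n \<ge> 0\<close> by (simp add: mult_le_0_iff)
  then show "lm (t, X t a) = m a" "lp (t, X t a) = p (a + t)"
    using WV[OF \<open>(t, a) \<in> K\<close>] by (auto simp: W_def V_def)
qed

text \<open>The graph of a \<open>C\<^sup>1\<close> solution cannot reach a fold: there the left side of
\<open>\<lambda>\<^sub>-(t, X t a) = m a\<close> has derivative zero in \<open>a\<close>, the right side has not.\<close>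

lemma solution_stops_at_fold:
  assumes sol: "C1_solution Lm Lp T lm lp" and t: "0 \<le> t" "t < T"
  shows "p (a + t) \<noteq> m a"
proof
  assume fold: "p (a + t) = m a"
  have "(t, X t a) \<in> strip T" using t by (simp add: strip_def)
  then have "(lm has_derivative (\<lambda>(h, k). dt T lm (t, X t a) * h + dx lm (t, X t a) * k))
      (at (t, X t a) within strip T)"
    using sol by (simp add: C1_solution_def C1_on_strip_def)
  from strip_space_slice[OF this t]
  have "((\<lambda>y. lm (t, y)) has_real_derivative dx lm (t, X t a)) (at (X t a))" by simp
  from DERIV_chain'[OF X_deriv_a this]
  have "((\<lambda>c. lm (t, X t c)) has_real_derivative dx lm (t, X t a) * (p (a + t) - m a)) (at a)" .
  then have "(m has_real_derivative 0) (at a)"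
    using solution_on_characteristics(1)[OF sol t] fold by simp
  then have "m' a = 0" using m_deriv DERIV_unique by blast
  then show False using m'_neg[of a] by simp
qed

end

section \<open>The solution before the first fold\<close>

text \<open>As \<open>p\<close> decreases from a value above \<open>m a\<close> at the point \<open>a\<close>, it can be at most \<open>m a\<close> at
\<open>a + t\<close> only if \<open>t > 0\<close> and \<open>p\<close> takes the value \<open>m a\<close> somewhere in between. This is a pair
on \<open>\<Sigma>\<close> with meeting time at most \<open>t\<close>.\<close>

lemma (in lagrangian_data) first_fold_time:
  assumes gap: "\<And>a. m a < p a"
    and first: "\<And>a b. a < b \<Longrightarrow> m a = p b \<Longrightarrow> t0 \<le> b - a"
    and t: "t < t0"
  shows "m a < p (a + t)"
proof (rule ccontr)
  assume "\<not> m a < p (a + t)"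
  then have le: "p (a + t) \<le> m a" by simp
  have "t > 0"
  proof (rule ccontr)
    assume "\<not> t > 0"
    then have "p a \<le> p (a + t)"
      using DERIV_neg_imp_decreasing[of "a + t" a p] p_deriv p'_neg by (cases "t = 0") fastforce+
    with le gap[of a] show False by simp
  qed
  then obtain b where b: "a \<le> b" "b \<le> a + t" "p b = m a"
    using IVT2'[of p "a + t" "m a" a] le gap[of a] p_cont[of "{a..a + t}"] by auto
  then have "a < b" using gap[of a] by (cases "a = b") auto
  from first[OF this b(3)[symmetric]] b t show False by simp
qed

text \<open>The absence of folds is demanded for negative times too, where it follows from \<open>m a < p a\<close>
and the monotonicity of \<open>p\<close>. In this way \<open>t = 0\<close> becomes an interior time for the inverse
function theorem.\<close>

locale shock_free_data = lagrangian_data +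
  fixes t0 :: real
  assumes t0_pos: "t0 > 0"
    and no_fold: "\<And>t a. t < t0 \<Longrightarrow> m a < p (a + t)"
begin

text \<open>The label of the characteristic of speed \<open>\<lambda>\<^sub>+\<close> that passes through \<open>(t, x)\<close>.\<close>

definition A :: "real \<Rightarrow> real \<Rightarrow> real" where
  "A t x = inv (X t) x"

lemma X_A [simp]: "X t (A t x) = x"
  by (simp add: A_def surj_X surj_f_inv_f)

lemma X_strict_mono:
  assumes t: "t < t0" and ab: "a < b"
  shows "X t a < X t b"
proof (rule DERIV_pos_imp_increasing[OF ab])
  fix c
  show "\<exists>y. DERIV (X t) c :> y \<and> 0 < y"
    using X_deriv_a[of t c] no_fold[OF t, of c] by (intro exI[of _ "p (c + t) - m c"]) simp
qed

lemma X_less_iff: "t < t0 \<Longrightarrow> X t a < X t b \<longleftrightarrow> a < b"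
  using X_strict_mono[of t a b] X_strict_mono[of t b a] by (cases a b rule: linorder_cases) auto

text \<open>By monotonicity the label of \<open>(t, x)\<close> exceeds \<open>c\<close> iff \<open>X t c < x\<close>, an open condition in
\<open>(t, x)\<close>. So labels are continuous wherever \<open>X t1\<close> is strictly monotone at the point \<open>a1\<close>.
The case \<open>t1 < t0\<close> gives the continuity of the solution, the case \<open>t1 = t0\<close> the approach to
the blowup point.\<close>

lemma A_tendsto:
  assumes below: "\<And>c. c < a1 \<Longrightarrow> X t1 c < X t1 a1"
    and above: "\<And>c. a1 < c \<Longrightarrow> X t1 a1 < X t1 c"
  shows "((\<lambda>z. A (fst z) (snd z)) \<longlongrightarrow> a1) (at (t1, X t1 a1) within {..<t0} \<times> UNIV)"
proof -
  let ?F = "at (t1, X t1 a1) within {..<t0} \<times> UNIV"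
  have early: "\<forall>\<^sub>F z in ?F. fst z < t0"
    by (auto simp: eventually_at_filter intro!: always_eventually)
  have lim: "((\<lambda>z. snd z - X (fst z) c) \<longlongrightarrow> X t1 a1 - X t1 c) ?F" for c
  proof -
    have "isCont (\<lambda>t. X t c) t1" using X_deriv_t DERIV_isCont by blast
    then have "((\<lambda>z. X (fst z) c) \<longlongrightarrow> X t1 c) ?F"
      by (rule isCont_tendsto_compose) (auto intro!: tendsto_eq_intros)
    then show ?thesis by (auto intro!: tendsto_eq_intros)
  qed
  show ?thesis
  proof (rule order_tendstoI)
    fix c assume "c < a1"
    then have "\<forall>\<^sub>F z in ?F. 0 < snd z - X (fst z) c"
      using below by (intro order_tendstoD[OF lim]) simp
    then show "\<forall>\<^sub>F z in ?F. c < A (fst z) (snd z)"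
      using early
    proof eventually_elim
      case (elim z)
      then have "X (fst z) c < X (fst z) (A (fst z) (snd z))" by simp
      with elim show ?case
        by (simp only: X_less_iff)
    qed
  next
    fix c assume "a1 < c"
    then have "\<forall>\<^sub>F z in ?F. snd z - X (fst z) c < 0"
      using above by (intro order_tendstoD[OF lim]) simp
    then show "\<forall>\<^sub>F z in ?F. A (fst z) (snd z) < c"
      using early
    proof eventually_elim
      case (elim z)
      then have "X (fst z) (A (fst z) (snd z)) < X (fst z) c" by simp
      with elim show ?case
        by (simp only: X_less_iff)
    qed
  qed
qed

text \<open>The derivative \<open>\<partial>X/\<partial>a\<close> as a function of \<open>(t, x)\<close>; it is also \<open>\<lambda>\<^sub>+ - \<lambda>\<^sub>-\<close>.\<close>

definition J :: "real \<times> real \<Rightarrow> real" where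
  "J z = p (A (fst z) (snd z) + fst z) - m (A (fst z) (snd z))"

lemma J_pos: "fst z < t0 \<Longrightarrow> 0 < J z"
  using no_fold by (simp add: J_def)

lemma J_nonzero: "z \<in> strip t0 \<Longrightarrow> J z \<noteq> 0"
  using J_pos[of z] by (auto simp: strip_def)

text \<open>The inverse function theorem for \<open>(t, a) \<mapsto> (t, X t a)\<close>, whose Jacobian determinant is \<open>J\<close>.\<close>

lemma A_has_derivative:
  assumes t: "fst z < t0"
  shows "((\<lambda>z. A (fst z) (snd z)) has_derivative
    (\<lambda>(h, k). (k - p (A (fst z) (snd z) + fst z) * h) / J z)) (at z)"
proof -
  obtain t x where z: "z = (t, x)" by fastforce
  define a where "a = A t x"
  have t: "t < t0" and x: "x = X t a" using t by (simp_all add: z a_def)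
  define T where "T = {..<t0} \<times> (UNIV :: real set)"
  have "open T" "z \<in> T" using t by (auto simp: T_def z open_Times)
  have j: "J (t, x) = p (a + t) - m a" by (simp add: J_def a_def)
  have lim: "((\<lambda>z. A (fst z) (snd z)) \<longlongrightarrow> a) (at z)"
    using A_tendsto[of a t] X_strict_mono[OF t] at_within_open[OF \<open>z \<in> T\<close> \<open>open T\<close>]
    by (simp add: z T_def x)
  have "((\<lambda>z. (fst z, A (fst z) (snd z))) has_derivative
      (\<lambda>(h, k). (h, (k - p (a + t) * h) / J z))) (at z)"
  proof (rule has_derivative_inverse_basic[OF _ _ _ _ \<open>open T\<close> \<open>z \<in> T\<close>])
    show "((\<lambda>z. (fst z, X (fst z) (snd z))) has_derivative
        (\<lambda>(h, k). (h, p (a + t) * h + J z * k))) (at (fst z, A (fst z) (snd z)))"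
      using has_derivative_Pair[OF has_derivative_fst[OF has_derivative_ident] X_has_derivative[of a t]]
      by (simp add: z a_def j case_prod_unfold)
    show "bounded_linear (\<lambda>(h, k). (h, (k - p (a + t) * h) / J z))"
      unfolding case_prod_beta
      by (intro bounded_linear_Pair bounded_linear_fst bounded_linear_divide[THEN bounded_linear_compose]
          bounded_linear_sub bounded_linear_snd bounded_linear_const_mult)
    show "(\<lambda>(h, k). (h, (k - p (a + t) * h) / J z)) \<circ> (\<lambda>(h, k). (h, p (a + t) * h + J z * k)) = id"
      using J_pos[of z] t by (auto simp: fun_eq_iff z)
    show "continuous (at z) (\<lambda>z. (fst z, A (fst z) (snd z)))"
      unfolding continuous_within
      using tendsto_Pair[OF tendsto_fst[OF tendsto_ident_at] lim] by (simp add: z a_def)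
  qed simp
  from has_derivative_snd[OF this] show ?thesis
    by (simp add: case_prod_unfold z a_def)
qed

definition lm :: "real \<times> real \<Rightarrow> real" where
  "lm z = m (A (fst z) (snd z))"

definition lp :: "real \<times> real \<Rightarrow> real" where
  "lp z = p (A (fst z) (snd z) + fst z)"

definition lm_x :: "real \<times> real \<Rightarrow> real" where
  "lm_x z = m' (A (fst z) (snd z)) / J z"

definition lp_x :: "real \<times> real \<Rightarrow> real" where
  "lp_x z = p' (A (fst z) (snd z) + fst z) / J z"

lemma lm_has_derivative:
  assumes "fst z < t0"
  shows "(lm has_derivative (\<lambda>(h, k). - (lp z * lm_x z) * h + lm_x z * k)) (at z within S)"
proof -
  have "(lm has_derivative
      (\<lambda>v. (case v of (h, k) \<Rightarrow> (k - lp z * h) / J z) * m' (A (fst z) (snd z)))) (at z within S)"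
    unfolding lm_def[abs_def] lp_def
    by (rule DERIV_compose_FDERIV[OF m_deriv
          has_derivative_at_withinI[OF A_has_derivative[OF assms]]])
  then show ?thesis
    by (rule has_derivative_eq_rhs)
      (use J_pos[OF assms] in \<open>auto simp: fun_eq_iff lm_x_def field_simps\<close>)
qed

lemma lp_has_derivative:
  assumes "fst z < t0"
  shows "(lp has_derivative (\<lambda>(h, k). - (lm z * lp_x z) * h + lp_x z * k)) (at z within S)"
proof -
  have "((\<lambda>z. A (fst z) (snd z) + fst z) has_derivative
      (\<lambda>v. (case v of (h, k) \<Rightarrow> (k - lp z * h) / J z) + fst v)) (at z within S)"
    unfolding lp_def
    by (intro has_derivative_add has_derivative_fst has_derivative_ident
          has_derivative_at_withinI[OF A_has_derivative[OF assms]])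
  from DERIV_compose_FDERIV[OF p_deriv this]
  have "(lp has_derivative (\<lambda>v. ((case v of (h, k) \<Rightarrow> (k - lp z * h) / J z) + fst v)
      * p' (A (fst z) (snd z) + fst z))) (at z within S)"
    unfolding lp_def[abs_def] .
  moreover have "lp z = J z + lm z" by (simp add: J_def lp_def lm_def)
  ultimately show ?thesis
    by (elim has_derivative_eq_rhs)
      (use J_pos[OF assms] in \<open>auto simp: fun_eq_iff lp_x_def field_simps\<close>)
qed

lemma A_continuous: "continuous_on (strip t0) (\<lambda>z. A (fst z) (snd z))"
  unfolding continuous_on_eq_continuous_within
  using has_derivative_continuous[OF has_derivative_at_withinI[OF A_has_derivative]]
  by (auto simp: strip_def)

lemma slopes_continuous: "continuous_on (strip t0) lm_x" "continuous_on (strip t0) lp_x"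
  unfolding lm_x_def[abs_def] lp_x_def[abs_def]
proof (safe intro!: continuous_on_divide)
  show "continuous_on (strip t0) J"
    unfolding J_def[abs_def]
    by (intro continuous_intros A_continuous continuous_on_compose2[OF m_cont[of UNIV]]
        continuous_on_compose2[OF p_cont[of UNIV]]; simp)
  then show "continuous_on (strip t0) J" .
  show "continuous_on (strip t0) (\<lambda>z. m' (A (fst z) (snd z)))"
    "continuous_on (strip t0) (\<lambda>z. p' (A (fst z) (snd z) + fst z))"
    by (intro continuous_intros A_continuous continuous_on_compose2[OF m'_cont]
        continuous_on_compose2[OF p'_cont]; simp)+
qed (use J_nonzero in blast)+

lemma lm_lp_is_solution: "C1_solution Lm Lp t0 lm lp"
  and dx_lm: "z \<in> strip t0 \<Longrightarrow> dx lm z = lm_x z"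
  and dx_lp: "z \<in> strip t0 \<Longrightarrow> dx lp z = lp_x z"
proof -
  have early: "fst z < t0" if "z \<in> strip t0" for z
    using that by (auto simp: strip_def)
  have conts: "continuous_on (strip t0) (\<lambda>z. - (lp z * lm_x z))"
    "continuous_on (strip t0) (\<lambda>z. - (lm z * lp_x z))"
    by (intro continuous_intros slopes_continuous has_derivative_continuous_on[OF lm_has_derivative]
        has_derivative_continuous_on[OF lp_has_derivative] early; assumption)+
  note lm = C1_on_strip_intro[OF lm_has_derivative[OF early] conts(1) slopes_continuous(1)]
  note lp = C1_on_strip_intro[OF lp_has_derivative[OF early] conts(2) slopes_continuous(2)]
  show "dx lm z = lm_x z" "dx lp z = lp_x z" if "z \<in> strip t0"
    using lm(3) lp(3) that by simp_all
  have "q (A 0 x) = x" for x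
    using X_A[of 0 x] unfolding X_0 .
  then have "lm (0, x) = Lm x" "lp (0, x) = Lp x" for x
    using Lm_q[of "A 0 x"] Lp_q[of "A 0 x"] by (simp_all add: lm_def lp_def)
  then show "C1_solution Lm Lp t0 lm lp"
    unfolding C1_solution_def using lm lp by simp
qed

text \<open>Every point is on some characteristic because \<open>X t\<close> is surjective.\<close>

lemma solution_unique:
  assumes "C1_solution Lm Lp t0 lm' lp'" and z: "z \<in> strip t0"
  shows "lm' z = lm z" "lp' z = lp z"
  using solution_on_characteristics[OF assms(1), of "fst z" "A (fst z) (snd z)"] z
  by (auto simp: lm_def lp_def strip_def)

lemma life_span_is_t0:
  assumes "p (a0 + t0) = m a0"
  shows "is_life_span Lm Lp t0"
  unfolding is_life_span_def
  using t0_pos lm_lp_is_solution solution_stops_at_fold[of _ _ _ t0 a0] assms by fastforce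

section \<open>Blowup at the first fold\<close>

lemma fold_le: "m a \<le> p (a + t0)"
proof (rule tendsto_lowerbound)
  show "((\<lambda>t. p (a + t)) \<longlongrightarrow> p (a + t0)) (at_left t0)"
    by (rule isCont_tendsto_compose[OF DERIV_isCont[OF p_deriv]]) (auto intro!: tendsto_intros)
  show "\<forall>\<^sub>F t in at_left t0. m a \<le> p (a + t)"
    using no_fold by (auto simp: eventually_at_filter intro!: always_eventually less_imp_le)
qed simp

text \<open>At time \<open>t0\<close> the map \<open>X t0\<close> is still monotone, so it can fail to be strictly increasing only
by being constant on an interval, and then the whole interval consists of folds.\<close>

lemma X_strict_at_t0:
  assumes cd: "c < d" and ex: "\<exists>a. c < a \<and> a < d \<and> p (a + t0) \<noteq> m a"
  shows "X t0 c < X t0 d"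
proof (rule ccontr)
  assume not: "\<not> X t0 c < X t0 d"
  have mono: "X t0 a \<le> X t0 b" if "a \<le> b" for a b
  proof (rule DERIV_nonneg_imp_nondecreasing[OF that])
    fix x show "\<exists>y. DERIV (X t0) x :> y \<and> 0 \<le> y"
      using X_deriv_a[of t0 x] fold_le[of x] by (intro exI[of _ "p (x + t0) - m x"]) simp
  qed
  obtain a where a: "a \<in> {c<..<d}" "p (a + t0) \<noteq> m a" using ex by auto
  have "X t0 c = X t0 x" if "x \<in> {c<..<d}" for x
    using mono[of c x] mono[of x d] not that by auto
  then have "(X t0 has_real_derivative 0) (at a)"
    by (intro has_field_derivative_transform_within_open[OF DERIV_const _ a(1)]) auto
  with X_deriv_a have "p (a + t0) - m a = 0" by (rule DERIV_unique)
  with a show False by simp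
qed

text \<open>In \<open>\<partial>\<lambda>\<^sub>-/\<partial>x = m' / J\<close> and \<open>\<partial>\<lambda>\<^sub>+/\<partial>x = p' / J\<close> the label tends to \<open>a0\<close>, so the numerators keep
away from zero, while \<open>J\<close> tends to its value at the fold, which is zero. The solution itself
takes only initial values and so remains bounded.\<close>

lemma gradient_blowup:
  assumes below: "\<And>c. c < a0 \<Longrightarrow> X t0 c < X t0 a0"
    and above: "\<And>c. a0 < c \<Longrightarrow> X t0 a0 < X t0 c"
    and fold: "p (a0 + t0) = m a0"
  shows "geometric_blowup_at t0 lm lp (t0, X t0 a0)" and "blows_up_at t0 lm lp (t0, X t0 a0)"
proof -
  let ?F = "at (t0, X t0 a0) within strip t0"
  have inside: "\<forall>\<^sub>F z in ?F. z \<in> strip t0"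
    by (auto simp: eventually_at_filter intro!: always_eventually)
  have A: "((\<lambda>z. A (fst z) (snd z)) \<longlongrightarrow> a0) ?F"
    by (rule tendsto_within_subset[OF A_tendsto[OF below above]]) (auto simp: strip_def)
  have At: "((\<lambda>z. A (fst z) (snd z) + fst z) \<longlongrightarrow> a0 + t0) ?F"
    by (auto intro!: tendsto_eq_intros A)
  have cont: "isCont m a" "isCont p a" "isCont m' a" "isCont p' a" for a
    using DERIV_isCont[OF m_deriv] DERIV_isCont[OF p_deriv] m'_cont p'_cont
    by (auto simp: continuous_on_eq_continuous_at)
  have "(J \<longlongrightarrow> p (a0 + t0) - m a0) ?F"
    unfolding J_def[abs_def]
    by (intro tendsto_diff isCont_tendsto_compose[OF cont(1) A] isCont_tendsto_compose[OF cont(2) At])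
  moreover have "\<forall>\<^sub>F z in ?F. J z \<noteq> 0"
    using inside by eventually_elim (rule J_nonzero)
  ultimately have J: "filterlim J (at 0) ?F"
    using fold by (simp add: filterlim_at)
  have "filterlim lm_x at_infinity ?F" "filterlim lp_x at_infinity ?F"
    unfolding lm_x_def[abs_def] lp_x_def[abs_def]
    using m'_neg[of a0] p'_neg[of "a0 + t0"]
    unfolding divide_inverse
    by (intro tendsto_mult_filterlim_at_infinity[OF isCont_tendsto_compose[OF cont(3) A]]
        tendsto_mult_filterlim_at_infinity[OF isCont_tendsto_compose[OF cont(4) At]]
        filterlim_compose[OF filterlim_inverse_at_infinity J]; simp)+
  moreover have "\<forall>\<^sub>F z in ?F. dx lm z = lm_x z" "\<forall>\<^sub>F z in ?F. dx lp z = lp_x z"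
    using inside by (eventually_elim, simp add: dx_lm dx_lp)+
  ultimately have inf: "filterlim (dx lm) at_infinity ?F" "filterlim (dx lp) at_infinity ?F"
    by (auto cong: filterlim_cong)
  moreover have "bounded (lm ` strip t0)" "bounded (lp ` strip t0)"
    by (auto simp: lm_def lp_def intro: bounded_subset[OF m_bdd] bounded_subset[OF p_bdd])
  ultimately show "geometric_blowup_at t0 lm lp (t0, X t0 a0)"
    by (simp add: geometric_blowup_at_def)
  have "(t0, X t0 a0) islimpt strip t0"
  proof -
    have "(t0, X t0 a0) \<in> closure (strip t0)"
      using t0_pos by (simp add: strip_def closure_Times)
    moreover have "(t0, X t0 a0) \<notin> strip t0" by (simp add: strip_def)
    ultimately show ?thesis by (auto simp: closure_def)
  qed
  then have "\<not> bounded (dx lm ` (strip t0 \<inter> ball (t0, X t0 a0) e))" if "e > 0" for e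
    using infinite_limit_imp_unbounded inf(1) that by blast
  moreover have "bounded (dx lm ` S)"
    if "bounded ((\<lambda>z. (lm z, lp z, dt t0 lm z, dx lm z, dt t0 lp z, dx lp z)) ` S)" for S
    using bounded_fst[OF bounded_snd[OF bounded_snd[OF bounded_snd[OF that]]]]
    by (simp add: image_image)
  ultimately show "blows_up_at t0 lm lp (t0, X t0 a0)"
    unfolding blows_up_at_def by blast
qed

end

section \<open>The Riemann invariants of the initial data\<close>

lemma bounded_C2_regular:
  assumes "bounded_C2 g"
  shows "(g has_real_derivative deriv g x) (at x)"
    and "(deriv g has_real_derivative deriv (deriv g) x) (at x)"
    and "bounded (range g)"
proof -
  have k: "(deriv ^^ k) g differentiable (at x)" if "k < 2" for k
    using assms that by (simp add: bounded_C2_def)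
  show "(g has_real_derivative deriv g x) (at x)"
    using k[of 0] by (simp add: DERIV_deriv_iff_real_differentiable)
  show "(deriv g has_real_derivative deriv (deriv g) x) (at x)"
    using k[of 1] by (simp add: DERIV_deriv_iff_real_differentiable)
  have "bounded (range ((deriv ^^ 0) g))"
    using assms unfolding bounded_C2_def by blast
  then show "bounded (range g)" by simp
qed

lemma riemann_invariant_regular:
  fixes c :: real
  assumes \<rho>: "bounded_C2 \<rho>0" and u: "bounded_C2 u0" and nz: "\<And>x. \<rho>0 x \<noteq> 0"
  defines "g \<equiv> \<lambda>x. u0 x + c / \<rho>0 x"
  shows "(g has_real_derivative deriv g x) (at x)"
    and "(deriv g has_real_derivative deriv (deriv g) x) (at x)"
proof -
  note D = bounded_C2_regular(1)[OF \<rho>] bounded_C2_regular(1)[OF u]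
    bounded_C2_regular(2)[OF \<rho>] bounded_C2_regular(2)[OF u]
  have g: "(g has_real_derivative deriv u0 x - c * deriv \<rho>0 x / (\<rho>0 x)\<^sup>2) (at x)" for x
    unfolding g_def using nz by (auto intro!: derivative_eq_intros D simp: power2_eq_square)
  then have g': "deriv g = (\<lambda>x. deriv u0 x - c * deriv \<rho>0 x / (\<rho>0 x)\<^sup>2)"
    by (auto intro!: DERIV_imp_deriv)
  show "(g has_real_derivative deriv g x) (at x)"
    using g by (simp add: g')
  have "\<exists>l. (deriv g has_real_derivative l) (at x)"
    unfolding g' by (rule exI) (auto intro!: derivative_eq_intros D simp: nz)
  then show "(deriv g has_real_derivative deriv (deriv g) x) (at x)"
    by (metis DERIV_imp_deriv)
qed

text \<open>The weight \<open>w = \<mu> / \<rho>\<^sub>0\<close> might a priori be unbounded, since \<open>\<rho>\<^sub>0\<close> may come close to zero. The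
monotonicity of the two invariants excludes this: that of \<open>u\<^sub>0 + w\<close> bounds \<open>w\<close> to the right
of the origin, that of \<open>u\<^sub>0 - w\<close> to the left of it.\<close>

lemma riemann_invariants_bounded:
  fixes w :: "real \<Rightarrow> real"
  assumes u: "bounded (range u0)" and w: "\<And>x. w x > 0"
    and minus: "\<And>x y. x \<le> y \<Longrightarrow> u0 y - w y \<le> u0 x - w x"
    and plus: "\<And>x y. x \<le> y \<Longrightarrow> u0 y + w y \<le> u0 x + w x"
  shows "bounded (range (\<lambda>x. u0 x - w x))" and "bounded (range (\<lambda>x. u0 x + w x))"
proof -
  obtain U where U: "\<And>x. \<bar>u0 x\<bar> \<le> U"
    using u by (auto simp: bounded_iff)
  have w_le: "w x \<le> 2 * U + w 0" for x
    using U[of x] U[of 0] minus[of x 0] plus[of 0 x] by (cases "x \<le> 0") auto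
  have "\<bar>u0 x - w x\<bar> \<le> 3 * U + w 0" "\<bar>u0 x + w x\<bar> \<le> 3 * U + w 0" for x
    using U[of x] w[of x] w_le[of x] by linarith+
  then show "bounded (range (\<lambda>x. u0 x - w x))" "bounded (range (\<lambda>x. u0 x + w x))"
    unfolding bounded_iff by auto
qed

section \<open>Passage to the mass coordinate\<close>

text \<open>The mass coordinate \<open>P\<close> has a slope bounded below because \<open>\<Lambda>\<^sub>+ - \<Lambda>\<^sub>-\<close> is bounded above; hence
it maps onto the whole line and the labels range over all reals.\<close>

lemma lagrangian_coordinates_exist:
  fixes Lm Lp :: "real \<Rightarrow> real"
  assumes gap: "\<And>x. Lm x < Lp x"
    and cm: "\<And>x. isCont Lm x" and cp: "\<And>x. isCont Lp x"
    and bm: "bounded (range Lm)" and bp: "bounded (range Lp)"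
  obtains P q F where "\<And>x. (P has_real_derivative 1 / (Lp x - Lm x)) (at x)"
    and "\<And>x. q (P x) = x" and "\<And>a. P (q a) = a"
    and "\<And>a. (q has_real_derivative Lp (q a) - Lm (q a)) (at a)"
    and "\<And>a. (F has_real_derivative Lp (q a)) (at a)"
proof -
  have ne: "Lp x - Lm x \<noteq> 0" for x using gap[of x] by simp
  obtain P where P: "\<And>x. (P has_real_derivative 1 / (Lp x - Lm x)) (at x)"
    by (rule real_antiderivative_exists[of "\<lambda>x. 1 / (Lp x - Lm x)"])
      (use cm cp ne in \<open>auto intro!: continuous_intros\<close>)
  obtain K1 K2 where "\<And>x. \<bar>Lm x\<bar> \<le> K1" "\<And>x. \<bar>Lp x\<bar> \<le> K2"
    using bm bp unfolding bounded_iff by auto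
  then have K: "Lp x - Lm x \<le> K1 + K2" for x
    by (smt (verit))
  define K where "K = K1 + K2"
  have K: "Lp x - Lm x \<le> K" for x using K by (simp add: K_def)
  have "K > 0" using gap[of 0] K[of 0] by simp
  have growth: "(y - x) / K \<le> P y - P x" if "x \<le> y" for x y
  proof -
    have "P x - x / K \<le> P y - y / K"
    proof (rule DERIV_nonneg_imp_nondecreasing[OF that, of "\<lambda>x. P x - x / K"])
      fix z
      have "1 / K \<le> 1 / (Lp z - Lm z)"
        using K[of z] gap[of z] \<open>K > 0\<close> by (intro divide_left_mono mult_pos_pos) simp_all
      then show "\<exists>l. DERIV (\<lambda>x. P x - x / K) z :> l \<and> 0 \<le> l"
        by (intro exI[of _ "1 / (Lp z - Lm z) - 1 / K"])
          (use \<open>K > 0\<close> in \<open>auto intro!: derivative_eq_intros P\<close>)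
    qed
    then show ?thesis by (simp add: diff_divide_distrib)
  qed
  have inj: "inj P"
  proof (rule linorder_injI)
    fix x y :: real assume "x < y"
    then have "0 < (y - x) / K" using \<open>K > 0\<close> by simp
    then show "P x \<noteq> P y" using growth[of x y] \<open>x < y\<close> by simp
  qed
  have Pcont: "continuous_on S P" for S
    by (rule DERIV_continuous_on[OF has_field_derivative_at_within[OF P]])
  have "\<exists>x. P x = a" for a
  proof -
    define r where "r = K * \<bar>a - P 0\<bar>"
    have r: "0 \<le> r" "r / K = \<bar>a - P 0\<bar>" using \<open>K > 0\<close> by (auto simp: r_def)
    have "P (- r) \<le> a" "a \<le> P r"
      using growth[of "- r" 0] growth[of 0 r] r by auto
    then show ?thesis
      using IVT'[of P "- r" a r] Pcont r by auto
  qed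
  then have surj: "surj P" by (metis surjI)
  define q where "q = inv P"
  have qP: "q (P x) = x" for x using inj by (simp add: q_def)
  have Pq: "P (q a) = a" for a using surj by (simp add: q_def surj_f_inv_f)
  have q: "(q has_real_derivative Lp (q a) - Lm (q a)) (at a)" for a
    using real_derivative_of_inverse[of P "\<lambda>x. 1 / (Lp x - Lm x)" "q a" q] P ne qP Pq by simp
  have "isCont (\<lambda>a. Lp (q a)) a" for a
    using DERIV_isCont[OF q] cp by (rule isCont_o2)
  then obtain F where "\<And>a. (F has_real_derivative Lp (q a)) (at a)"
    using real_antiderivative_exists by blast
  with P qP Pq q that show thesis by blast
qed

lemma meet_time_eq:
  assumes P: "\<And>x. (P has_real_derivative 1 / (Lp x - Lm x)) (at x)" and "\<alpha> \<le> \<beta>"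
  shows "meet_time Lm Lp \<alpha> \<beta> = P \<beta> - P \<alpha>"
  unfolding meet_time_def
  by (intro integral_unique fundamental_theorem_of_calculus)
    (use assms in \<open>auto simp: has_real_derivative_iff_has_vector_derivative[symmetric]
      intro: has_field_derivative_at_within\<close>)

text \<open>The integrand of \<open>meet_place\<close> is \<open>2 \<Lambda>\<^sub>+ / (\<Lambda>\<^sub>+ - \<Lambda>\<^sub>-) - 1\<close>, which has the antiderivative
\<open>2 F(P(x)) - x\<close>.\<close>

lemma meet_place_eq:
  assumes P: "\<And>x. (P has_real_derivative 1 / (Lp x - Lm x)) (at x)"
    and F: "\<And>x. (F has_real_derivative Lp x) (at (P x))"
    and gap: "\<And>x. Lm x < Lp x" and "\<alpha> \<le> \<beta>"
  shows "meet_place Lm Lp \<alpha> \<beta> = \<alpha> + (F (P \<beta>) - F (P \<alpha>))"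
proof -
  have "((\<lambda>x. 2 * F (P x) - x) has_real_derivative (Lp x + Lm x) / (Lp x - Lm x)) (at x)" for x
    using gap[of x]
    by (auto intro!: derivative_eq_intros DERIV_chain'[OF P F] simp: field_simps)
  then have "((\<lambda>\<zeta>. (Lp \<zeta> + Lm \<zeta>) / (Lp \<zeta> - Lm \<zeta>)) has_integral
      (2 * F (P \<beta>) - \<beta>) - (2 * F (P \<alpha>) - \<alpha>)) {\<alpha>..\<beta>}"
    by (intro fundamental_theorem_of_calculus \<open>\<alpha> \<le> \<beta>\<close>)
      (auto simp: has_real_derivative_iff_has_vector_derivative[symmetric]
        intro: has_field_derivative_at_within)
  then show ?thesis
    unfolding meet_place_def by (simp add: integral_unique field_simps)
qed

section \<open>The degeneracy function along the curve of meeting pairs\<close>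

text \<open>The sign of \<open>deriv f\<close> carries information only once \<open>f\<close> is known to be differentiable. The
local inverse of \<open>\<Lambda>\<^sub>+\<close> makes \<open>\<beta>(\<alpha>)\<close> differentiable, and the second derivatives of the data do
the rest.\<close>

lemma f_fun_differentiable:
  fixes Lm Lp :: "real \<Rightarrow> real"
  assumes Lm: "\<And>x. (Lm has_real_derivative deriv Lm x) (at x)"
    and Lp: "\<And>x. (Lp has_real_derivative deriv Lp x) (at x)"
    and Lm2: "(deriv Lm has_real_derivative Lm'') (at \<alpha>)"
    and Lp2: "(deriv Lp has_real_derivative Lp'') (at \<beta>)"
    and neg: "\<And>x. deriv Lp x < 0" and inj: "inj Lp" and gap: "\<And>x. Lm x < Lp x"
    and \<Sigma>: "Lm \<alpha> = Lp \<beta>"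
  shows "(f_fun Lm Lp has_real_derivative deriv (f_fun Lm Lp) \<alpha>) (at \<alpha>)"
proof -
  have b: "beta_of Lm Lp \<alpha> = \<beta>" using inj by (simp add: beta_of_def \<Sigma>)
  have "(inv Lp has_real_derivative inverse (deriv Lp \<beta>)) (at (Lm \<alpha>))"
    unfolding \<Sigma> using neg[of \<beta>] inj by (intro real_derivative_of_inverse[OF Lp]) auto
  from DERIV_chain'[OF Lm this]
  obtain b' where b': "(beta_of Lm Lp has_real_derivative b') (at \<alpha>)"
    unfolding beta_of_def[abs_def] by blast
  have c: "((\<lambda>x. g (beta_of Lm Lp x)) has_real_derivative g' * b') (at \<alpha>)"
    if "(g has_real_derivative g') (at \<beta>)" for g g'
    using DERIV_chain'[OF b'] that by (simp add: b)
  have "\<exists>l. (f_fun Lm Lp has_real_derivative l) (at \<alpha>)"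
    unfolding f_fun_def[abs_def]
    by (rule exI, rule DERIV_diff; rule DERIV_divide)
      (use gap[of \<alpha>] gap[of \<beta>] in \<open>auto intro!: DERIV_diff c Lm Lp Lm2 Lp2 simp: b\<close>)
  then show ?thesis by (metis DERIV_imp_deriv)
qed

text \<open>In terms of labels, \<open>f(\<alpha>)\<close> is \<open>(m' a - p' b) / ((\<Lambda>\<^sub>+ - \<Lambda>\<^sub>-)(\<alpha>) (\<Lambda>\<^sub>+ - \<Lambda>\<^sub>-)(\<beta>))\<close> with \<open>\<alpha> = q a\<close>,
\<open>\<beta>(\<alpha>) = q b\<close>. If \<open>p (a + t) = m a\<close> holds on an interval, then \<open>b = a + t\<close> and
differentiation gives \<open>p' b = m' a\<close>.\<close>

lemma f_fun_zero_on_flat_fold: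
  fixes Lm Lp q :: "real \<Rightarrow> real"
  assumes Lm: "\<And>x. (Lm has_real_derivative deriv Lm x) (at x)"
    and Lp: "\<And>x. (Lp has_real_derivative deriv Lp x) (at x)"
    and q: "\<And>a. (q has_real_derivative Lp (q a) - Lm (q a)) (at a)"
    and inj: "inj Lp" and gap: "\<And>x. Lm x < Lp x"
    and fold: "\<And>a. a \<in> {c<..<d} \<Longrightarrow> Lp (q (a + t)) = Lm (q a)"
    and a: "a \<in> {c<..<d}"
  shows "f_fun Lm Lp (q a) = 0"
proof -
  let ?D = "\<lambda>a. Lp (q a) - Lm (q a)"
  have "((\<lambda>a. Lm (q a)) has_real_derivative deriv Lm (q a) * ?D a) (at a)"
    by (rule DERIV_chain'[OF q Lm])
  moreover have "((\<lambda>a. Lp (q (a + t))) has_real_derivative deriv Lp (q (a + t)) * ?D (a + t)) (at a)"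
    by (rule DERIV_chain'[OF q[THEN DERIV_shift[THEN iffD1]] Lp])
  then have "((\<lambda>a. Lm (q a)) has_real_derivative deriv Lp (q (a + t)) * ?D (a + t)) (at a)"
    by (rule has_field_derivative_transform_within_open[OF _ _ a]) (use fold in auto)
  ultimately have "deriv Lm (q a) * ?D a = deriv Lp (q (a + t)) * ?D (a + t)"
    by (rule DERIV_unique)
  moreover have "beta_of Lm Lp (q a) = q (a + t)"
    unfolding beta_of_def fold[OF a, symmetric] using inj by simp
  ultimately show ?thesis
    unfolding f_fun_def using gap[of "q a"] gap[of "q (a + t)"] by (simp add: field_simps)
qed

section \<open>The life span and the blowup point\<close>

theorem theorem3p1:
  fixes \<mu> :: real and \<rho>0 u0 Lm Lp :: "real \<Rightarrow> real" and \<alpha>0 \<beta>0 t0 x0 :: real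
  defines "Lm \<equiv> Lambda_minus \<mu> \<rho>0 u0" and "Lp \<equiv> Lambda_plus \<mu> \<rho>0 u0"
  defines "t0 \<equiv> meet_time Lm Lp \<alpha>0 \<beta>0" and "x0 \<equiv> meet_place Lm Lp \<alpha>0 \<beta>0"
  assumes "\<mu> > 0"
    and "bounded_C2 \<rho>0" and "bounded_C2 u0"
    and "\<And>x. Lm x < Lp x"
    and "\<And>x. deriv Lm x < 0" and "\<And>x. deriv Lp x < 0"
    and "\<alpha>0 < \<beta>0" and "Lm \<alpha>0 = Lp \<beta>0"
    and "f_fun Lm Lp \<alpha>0 = 0" and "deriv (f_fun Lm Lp) \<alpha>0 < 0"
    and earliest: "\<And>\<alpha> \<beta>. (\<alpha>, \<beta>) \<in> Sigma_curve Lm Lp \<Longrightarrow> t0 \<le> meet_time Lm Lp \<alpha> \<beta>"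
  shows "is_life_span Lm Lp t0 \<and>
    (\<exists>lm lp. C1_solution Lm Lp t0 lm lp \<and>
       (\<forall>lm' lp'. C1_solution Lm Lp t0 lm' lp' \<longrightarrow>
          (\<forall>z\<in>strip t0. lm' z = lm z \<and> lp' z = lp z)) \<and>
       blows_up_at t0 lm lp (t0, x0) \<and>
       geometric_blowup_at t0 lm lp (t0, x0))"
proof -
  note gap = assms(8) and Lm_neg = assms(9) and Lp_neg = assms(10)
  have Lm_eq: "Lm = (\<lambda>x. u0 x + (- \<mu>) / \<rho>0 x)" and Lp_eq: "Lp = (\<lambda>x. u0 x + \<mu> / \<rho>0 x)"
    by (auto simp: Lm_def Lp_def Lambda_minus_def Lambda_plus_def)
  \<comment> \<open>As \<open>\<mu> / 0 = 0\<close>, the strict gap also excludes vacuum.\<close>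
  have w_pos: "\<mu> / \<rho>0 x > 0" for x
    using gap[of x] by (simp add: Lm_eq Lp_eq)
  then have nz: "\<rho>0 x \<noteq> 0" for x
    by (metis div_by_0 less_irrefl)
  have Lm: "(Lm has_real_derivative deriv Lm x) (at x)"
    and Lm2: "(deriv Lm has_real_derivative deriv (deriv Lm) x) (at x)"
    and Lp: "(Lp has_real_derivative deriv Lp x) (at x)"
    and Lp2: "(deriv Lp has_real_derivative deriv (deriv Lp) x) (at x)" for x
    unfolding Lm_eq Lp_eq
    by (intro riemann_invariant_regular[OF \<open>bounded_C2 \<rho>0\<close> \<open>bounded_C2 u0\<close> nz])+
  have Lm_dec: "Lm y < Lm x" and Lp_dec: "Lp y < Lp x" if "x < y" for x y
    using DERIV_neg_imp_decreasing[OF that] Lm Lm_neg Lp Lp_neg by blast+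
  have inj: "inj Lp"
    by (rule linorder_injI) (use Lp_dec in fastforce)
  have "Lm y \<le> Lm x" "Lp y \<le> Lp x" if "x \<le> y" for x y
    using Lm_dec[of x y] Lp_dec[of x y] that by (auto simp: le_less)
  then have bdd: "bounded (range Lm)" "bounded (range Lp)"
    using riemann_invariants_bounded[of u0 "\<lambda>x. \<mu> / \<rho>0 x"] w_pos
      bounded_C2_regular(3)[OF \<open>bounded_C2 u0\<close>]
    by (simp_all add: Lm_eq Lp_eq)
  obtain P q F where P: "\<And>x. (P has_real_derivative 1 / (Lp x - Lm x)) (at x)"
    and qP: "\<And>x. q (P x) = x" and Pq: "\<And>a. P (q a) = a"
    and q: "\<And>a. (q has_real_derivative Lp (q a) - Lm (q a)) (at a)"
    and F: "\<And>a. (F has_real_derivative Lp (q a)) (at a)"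
    using lagrangian_coordinates_exist[OF gap DERIV_isCont[OF Lm] DERIV_isCont[OF Lp] bdd] by blast
  define m' where "m' = (\<lambda>a. deriv Lm (q a) * (Lp (q a) - Lm (q a)))"
  define p' where "p' = (\<lambda>a. deriv Lp (q a) * (Lp (q a) - Lm (q a)))"
  have cont_q: "continuous_on UNIV (\<lambda>a. g (q a))" if "\<And>x. isCont g x" for g :: "real \<Rightarrow> real"
    using isCont_o2[OF DERIV_isCont[OF q] that] by (simp add: continuous_on_eq_continuous_at)
  interpret lagrangian_data Lm Lp q "\<lambda>a. Lm (q a)" "\<lambda>a. Lp (q a)" m' p' F
  proof
    show "((\<lambda>a. Lm (q a)) has_real_derivative m' a) (at a)"
      "((\<lambda>a. Lp (q a)) has_real_derivative p' a) (at a)" for a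
      unfolding m'_def p'_def by (rule DERIV_chain'[OF q Lm] DERIV_chain'[OF q Lp])+
    show "continuous_on UNIV m'" "continuous_on UNIV p'"
      unfolding m'_def p'_def
      by (intro continuous_intros cont_q DERIV_isCont[OF Lm] DERIV_isCont[OF Lp]
          DERIV_isCont[OF Lm2] DERIV_isCont[OF Lp2])+
    show "m' a < 0" "p' a < 0" for a
      unfolding m'_def p'_def using gap[of "q a"] Lm_neg[of "q a"] Lp_neg[of "q a"]
      by (simp_all add: mult_less_0_iff)
    show "surj q" using qP by (metis surjI)
    show "bounded (range (\<lambda>a. Lm (q a)))" "bounded (range (\<lambda>a. Lp (q a)))"
      by (auto intro: bounded_subset[OF bdd(1)] bounded_subset[OF bdd(2)])
  qed (simp_all add: q F)
  define a0 where "a0 = P \<alpha>0"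
  have P_mono: "P x < P y" if "x < y" for x y
    using DERIV_pos_imp_increasing[OF that] P gap by (metis diff_gt_0_iff_gt zero_less_divide_1_iff)
  have q_mono: "q a < q b" if "a < b" for a b
    using DERIV_pos_imp_increasing[OF that] q gap by (metis diff_gt_0_iff_gt)
  have t0: "t0 = P \<beta>0 - P \<alpha>0"
    unfolding t0_def using \<open>\<alpha>0 < \<beta>0\<close> by (intro meet_time_eq P) simp
  have "t0 > 0" using P_mono[OF \<open>\<alpha>0 < \<beta>0\<close>] t0 by simp
  have "t0 \<le> b - a" if "a < b" "Lm (q a) = Lp (q b)" for a b
    using earliest[of "q a" "q b"] q_mono[OF \<open>a < b\<close>] that meet_time_eq[OF P, of "q a" "q b"]
    by (simp add: Sigma_curve_def Pq)
  from first_fold_time[OF gap this]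
  interpret shock_free_data Lm Lp q "\<lambda>a. Lm (q a)" "\<lambda>a. Lp (q a)" m' p' F t0
    by unfold_locales (use \<open>t0 > 0\<close> in auto)
  have fold: "Lp (q (a0 + t0)) = Lm (q a0)"
    by (simp add: a0_def t0 qP \<open>Lm \<alpha>0 = Lp \<beta>0\<close>)
  have x0: "x0 = X t0 a0"
    unfolding x0_def X_def a0_def t0
    using meet_place_eq[OF P _ gap, of F \<alpha>0 \<beta>0] F[of "P _"] \<open>\<alpha>0 < \<beta>0\<close>
    by (simp add: qP)
  have f: "((\<lambda>a. f_fun Lm Lp (q a)) has_real_derivative
      deriv (f_fun Lm Lp) \<alpha>0 * (Lp \<alpha>0 - Lm \<alpha>0)) (at a0)"
    using DERIV_chain'[OF q, of "f_fun Lm Lp" _ a0]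
      f_fun_differentiable[OF Lm Lp Lm2 Lp2 Lp_neg inj gap \<open>Lm \<alpha>0 = Lp \<beta>0\<close>]
    by (simp add: a0_def qP)
  \<comment> \<open>A flat piece of \<open>X t0\<close> next to \<open>a0\<close> would be a piece of \<open>\<Sigma>\<close> on which \<open>f\<close> vanishes.\<close>
  have strict: "X t0 c < X t0 d" if cd: "c < d" "c = a0 \<or> d = a0" for c d
  proof (rule X_strict_at_t0[OF \<open>c < d\<close>])
    obtain a where "a \<in> {c<..<d}" "f_fun Lm Lp (q a) \<noteq> 0"
      using decreasing_zero_isolated[OF f _ _ cd] \<open>deriv (f_fun Lm Lp) \<alpha>0 < 0\<close> gap[of \<alpha>0]
        \<open>f_fun Lm Lp \<alpha>0 = 0\<close>
      by (auto simp: a0_def qP mult_less_0_iff)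
    then show "\<exists>a. c < a \<and> a < d \<and> Lp (q (a + t0)) \<noteq> Lm (q a)"
      using f_fun_zero_on_flat_fold[OF Lm Lp q inj gap, of c d t0 a] by auto
  qed
  have "geometric_blowup_at t0 lm lp (t0, x0)" "blows_up_at t0 lm lp (t0, x0)"
    unfolding x0 using strict fold by (auto intro: gradient_blowup)
  then show ?thesis
    using life_span_is_t0[OF fold] lm_lp_is_solution solution_unique by blast
qed

end
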